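(* Let $d, n, k$ be positive integers with $d$ and $n$ coprime. Then there is a partition of the infinite set $[kd,\infty)$ of integers into finite sets $X$ for which $\sigma X = n/d$ (that is, every member $X$ of the partition is a finite set with $\sigma X = n/d$).
   Context: $\mathbf{N} = \{1,2,3,\ldots\}$. For a positive integer $x$, $[x,\infty)$ denotes the set of all integers $z \ge x$. For a set $X \subseteq \mathbf{N}$, $\sigma X := \sum_{x\in X} \frac{1}{x}$, the sum of the reciprocals of the elements of $X$ (possibly $\infty$), with $\sigma\emptyset := 0$. *)

theory Defs
  imports "HOL-Analysis.Infinite_Sum" "HOL-Library.Extended_Nonnegative_Real"
    "HOL-Library.Disjoint_Sets"
begin

text \<open>The extended-valued sum makes \<open>sigma X\<close> infinite when the reciprocals of \<open>X\<close> diverge.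
  It is only meant for sets of positive integers.\<close>

definition sigma :: "nat set \<Rightarrow> ennreal" where
  "sigma X = (\<Sum>\<^sub>\<infinity>x\<in>X. ennreal (1 / real x))"

end

theory Submission
  imports Defs "HOL-Analysis.Harmonic_Numbers"
begin

text \<open>Every non-negative rational is a sum of distinct unit fractions whose denominators exceed
  any prescribed bound (\<open>egyptian_fraction_beyond\<close>). Hence the blocks of the partition can be
  chosen one at a time: if finitely many finite blocks have been chosen and \<open>x \<ge> k d\<close> is not yet
  covered, then \<open>n/d - 1/x \<ge> 0\<close>, because \<open>1/x \<le> 1/(k d) \<le> n/d\<close>, and an expansion of this
  difference into unit fractions with denominators beyond \<open>x\<close> and beyond everything used so far
  completes \<open>x\<close> to a new block. Processing the integers \<open>x\<close> in increasing order covers all of them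
  (\<open>greedy_partition\<close>).

  The bound on the denominators costs nothing because the harmonic series diverges: summing
  consecutive unit fractions, starting beyond the bound, until the next one would overshoot leaves
  a remainder smaller than that next fraction. The Fibonacci--Sylvester greedy algorithm then
  expands the remainder with larger denominators.\<close>

text \<open>This is the Fibonacci--Sylvester algorithm. Subtracting the largest unit fraction \<open>1/c\<close> not
  exceeding \<open>a/b\<close> leaves \<open>(c a - b) / (b c)\<close>, whose numerator is smaller than \<open>a\<close> by the
  minimality of \<open>c\<close>, so the process stops. This remainder is below \<open>1/c\<close>, because
  \<open>c a - b < a \<le> b\<close>, so the denominators increase strictly.\<close>

lemma egyptian_fraction_of_small:
  fixes a b m :: nat
  assumes "b > 0" and "m > 0" and "a * m < b"
  shows "\<exists>X. finite X \<and> X \<subseteq> {m<..} \<and> (\<Sum>x\<in>X. 1 / real x) = real a / real b"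
  using assms
proof (induction a arbitrary: b m rule: less_induct)
  case (less a)
  show ?case
  proof (cases "a = 0")
    case True
    then show ?thesis by (intro exI[of _ "{}"]) auto
  next
    case False
    define c where "c = (LEAST c. b \<le> c * a)"
    have "b \<le> b * a" using False by simp
    then have c: "b \<le> c * a" unfolding c_def by (rule LeastI)
    have "m < c"
    proof (rule ccontr)
      assume "\<not> m < c"
      then have "c \<le> m" by (rule leI)
      then have "c * a \<le> m * a" by (rule mult_le_mono1)
      with c have "b \<le> m * a" by (rule le_trans)
      then show False using less.prems(3) by (simp add: mult.commute)
    qed
    then have "c - 1 < (LEAST c. b \<le> c * a)"
      unfolding c_def[symmetric] by simp
    then have "\<not> b \<le> (c - 1) * a" by (rule not_less_Least)
    moreover have "c * a = (c - 1) * a + a"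
      using \<open>m < c\<close> by (cases c) auto
    ultimately have dec: "c * a - b < a" using c False by linarith
    have "a \<le> a * m" using less.prems(2) by simp
    then have "c * a - b < b" using dec less.prems(3) by linarith
    moreover have "c > 0" using \<open>m < c\<close> by simp
    ultimately have small: "(c * a - b) * c < b * c" by (rule mult_less_mono1)
    have pos: "b * c > 0" using \<open>c > 0\<close> less.prems(1) by (rule mult_pos_pos[rotated])
    obtain Y where Y: "finite Y" "Y \<subseteq> {c<..}"
      "(\<Sum>x\<in>Y. 1 / real x) = real (c * a - b) / real (b * c)"
      using less.IH[OF dec pos \<open>c > 0\<close> small] by (elim exE conjE) (rule that)
    have "real (c * a - b) = real c * real a - real b"
      using c by (simp add: of_nat_diff)
    then have "1 / real c + real (c * a - b) / real (b * c) = real a / real b"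
      using \<open>c > 0\<close> less.prems(1) by (simp add: field_simps)
    moreover have "c \<notin> Y" using Y by auto
    ultimately have "(\<Sum>x\<in>insert c Y. 1 / real x) = real a / real b"
      using Y by simp
    moreover have "insert c Y \<subseteq> {m<..}" using Y \<open>m < c\<close> by auto
    ultimately show ?thesis using Y(1) by (intro exI[of _ "insert c Y"]) auto
  qed
qed

lemma harmonic_block_exceeds: "\<exists>M. (\<Sum>x\<in>{N<..M}. 1 / real x) > r"
proof -
  have "filterlim (harm :: nat \<Rightarrow> real) at_top sequentially" by (rule harm_at_top)
  then have "eventually (\<lambda>M. harm M > r + harm N) sequentially"
    by (auto simp: filterlim_at_top_dense)
  then have "eventually (\<lambda>M. harm M > r + harm N \<and> M \<ge> N) sequentially"
    using eventually_ge_at_top eventually_conj by blast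
  then obtain M where M: "harm M > r + harm N" "M \<ge> N"
    by (auto simp: eventually_sequentially)
  have "(harm M :: real) = (\<Sum>x\<in>{1..N} \<union> {N<..M}. 1 / real x)"
    unfolding harm_def inverse_eq_divide using M by (intro sum.cong refl) auto
  also have "\<dots> = (\<Sum>x\<in>{1..N}. 1 / real x) + (\<Sum>x\<in>{N<..M}. 1 / real x)"
    by (intro sum.union_disjoint) auto
  also have "(\<Sum>x\<in>{1..N}. 1 / real x) = harm N"
    unfolding harm_def inverse_eq_divide ..
  finally have "harm M = harm N + (\<Sum>x\<in>{N<..M}. 1 / real x)" .
  then show ?thesis using M by auto
qed

text \<open>With \<open>M\<close> the first index at which the harmonic block starting beyond \<open>N\<close> exceeds \<open>r\<close>, the
  part of \<open>r\<close> not exhausted by the block ending at \<open>M - 1\<close> is less than \<open>1/M\<close>. Its greedy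
  expansion uses only denominators beyond \<open>M\<close>, hence none from the block.\<close>

lemma egyptian_fraction_beyond:
  fixes r :: real
  assumes "r \<in> \<rat>" and "r \<ge> 0"
  shows "\<exists>X. finite X \<and> X \<subseteq> {N<..} \<and> (\<Sum>x\<in>X. 1 / real x) = r"
proof -
  define S where "S = (\<lambda>M. \<Sum>x\<in>{N<..M}. 1 / real x)"
  define M where "M = (LEAST M. S M > r)"
  have M: "S M > r"
    unfolding M_def using harmonic_block_exceeds[of r N] unfolding S_def by (rule LeastI_ex)
  have "M > N"
  proof (rule ccontr)
    assume "\<not> M > N"
    then have "S M = 0" by (simp add: S_def)
    then show False using M assms by simp
  qed
  then have "M - 1 < (LEAST M. S M > r)"
    unfolding M_def[symmetric] by simp
  then have le: "S (M - 1) \<le> r"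
    using not_less_Least by (metis not_less)
  have "{N<..M} = insert M {N<..M - 1}" using \<open>M > N\<close> by auto
  then have step: "S M = S (M - 1) + 1 / real M"
    using \<open>M > N\<close> by (simp add: S_def)
  have "S (M - 1) \<in> \<rat>" unfolding S_def by (intro Rats_sum) simp
  then have "r - S (M - 1) \<in> \<rat>" using assms by simp
  then obtain a b :: nat where ab: "b \<noteq> 0" "\<bar>r - S (M - 1)\<bar> = real a / real b"
    by (rule Rats_abs_nat_div_natE)
  then have ab': "r - S (M - 1) = real a / real b" using le by simp
  then have "real a / real b < 1 / real M" using M step by simp
  then have "real (a * M) < real b" using ab(1) \<open>M > N\<close> by (simp add: field_simps)
  then have "a * M < b" by (simp only: of_nat_less_iff)
  then obtain Y where Y: "finite Y" "Y \<subseteq> {M<..}" "(\<Sum>x\<in>Y. 1 / real x) = real a / real b"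
    using egyptian_fraction_of_small[of b M a] ab(1) \<open>M > N\<close> by auto
  have "{N<..M - 1} \<inter> Y = {}" using Y by fastforce
  then have "(\<Sum>x\<in>{N<..M - 1} \<union> Y. 1 / real x) = S (M - 1) + real a / real b"
    using Y by (simp add: sum.union_disjoint S_def)
  then have "(\<Sum>x\<in>{N<..M - 1} \<union> Y. 1 / real x) = r" using ab' by simp
  moreover have "{N<..M - 1} \<union> Y \<subseteq> {N<..}" using Y \<open>M > N\<close> by auto
  ultimately show ?thesis using Y(1) by (intro exI[of _ "{N<..M - 1} \<union> Y"]) auto
qed

text \<open>The family of blocks is built in stages; stage \<open>i\<close> makes sure that \<open>i\<close>, if it lies in \<open>S\<close>, is
  covered, adding a block only if needed. Each stage has used only finitely many elements, so the
  hypothesis always supplies a block disjoint from the earlier ones.\<close>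

lemma greedy_partition:
  fixes S :: "nat set"
  assumes block: "\<And>F x. finite F \<Longrightarrow> x \<in> S - F \<Longrightarrow>
    \<exists>X. finite X \<and> x \<in> X \<and> X \<subseteq> S - F \<and> Q X"
  shows "\<exists>P. partition_on S P \<and> (\<forall>X\<in>P. finite X \<and> Q X)"
proof -
  define inv where "inv = (\<lambda>i (\<A> :: nat set set).
    finite \<A> \<and> (\<forall>X\<in>\<A>. finite X \<and> X \<noteq> {} \<and> X \<subseteq> S \<and> Q X) \<and> disjoint \<A> \<and>
    S \<inter> {..<i} \<subseteq> \<Union>\<A>)"
  have "\<exists>\<A>. \<forall>i. inv i (\<A> i) \<and> \<A> i \<subseteq> \<A> (Suc i)"
  proof (rule dependent_nat_choice)
    show "\<exists>\<A>. inv 0 \<A>" by (intro exI[of _ "{}"]) (simp add: inv_def)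
  next
    fix \<A> i assume inv: "inv i \<A>"
    show "\<exists>\<B>. inv (Suc i) \<B> \<and> \<A> \<subseteq> \<B>"
    proof (cases "i \<in> S - \<Union>\<A>")
      case False
      then have "inv (Suc i) \<A>" using inv unfolding inv_def lessThan_Suc by auto
      then show ?thesis by blast
    next
      case True
      have "finite (\<Union>\<A>)" using inv by (auto simp: inv_def)
      from block[OF this True] obtain X where
        X: "finite X" "i \<in> X" "X \<subseteq> S - \<Union>\<A>" "Q X" by blast
      have "disjoint (insert X \<A>)"
        using inv X(3) unfolding inv_def pairwise_insert disjnt_def by blast
      then have "inv (Suc i) (insert X \<A>)"
        using inv X unfolding inv_def lessThan_Suc by auto
      then show ?thesis by blast
    qed
  qed
  then obtain \<A> where inv: "\<And>i. inv i (\<A> i)" and step: "\<And>i. \<A> i \<subseteq> \<A> (Suc i)"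
    by blast
  have mono: "\<A> i \<subseteq> \<A> j" if "i \<le> j" for i j
    using lift_Suc_mono_le[of \<A>, OF step that] .
  have "partition_on S (\<Union>i. \<A> i)"
  proof (rule partition_onI)
    show "\<Union>(\<Union>i. \<A> i) = S"
    proof
      show "\<Union>(\<Union>i. \<A> i) \<subseteq> S" using inv unfolding inv_def by blast
      show "S \<subseteq> \<Union>(\<Union>i. \<A> i)"
      proof
        fix x assume "x \<in> S"
        then have "x \<in> \<Union>(\<A> (Suc x))" using inv[of "Suc x"] unfolding inv_def by auto
        then show "x \<in> \<Union>(\<Union>i. \<A> i)" by blast
      qed
    qed
  next
    fix X Y assume "X \<in> (\<Union>i. \<A> i)" "Y \<in> (\<Union>i. \<A> i)" and "X \<noteq> Y"
    then obtain i j where "X \<in> \<A> i" "Y \<in> \<A> j" by blast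
    then have "X \<in> \<A> (max i j)" "Y \<in> \<A> (max i j)"
      using mono[of i "max i j"] mono[of j "max i j"] by auto
    moreover have "disjoint (\<A> (max i j))" using inv unfolding inv_def by blast
    ultimately show "disjnt X Y" using \<open>X \<noteq> Y\<close> by (auto simp: pairwise_def)
  next
    show "{} \<notin> (\<Union>i. \<A> i)" using inv unfolding inv_def by blast
  qed
  moreover have "\<forall>X\<in>(\<Union>i. \<A> i). finite X \<and> Q X" using inv unfolding inv_def by blast
  ultimately show ?thesis by blast
qed

lemma sigma_finite:
  assumes "finite X"
  shows "sigma X = ennreal (\<Sum>x\<in>X. 1 / real x)"
  using assms by (simp add: sigma_def sum_ennreal)

theorem theorem1:
  fixes d n k :: nat
  assumes "d > 0" and "n > 0" and "k > 0"
    and "coprime d n"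
  shows "\<exists>P. partition_on {k * d..} P \<and>
    (\<forall>X\<in>P. finite X \<and> sigma X = ennreal (real n / real d))"
proof (rule greedy_partition)
  fix F :: "nat set" and x
  assume F: "finite F" and x: "x \<in> {k * d..} - F"
  have "d \<le> k * d" using assms(3) by simp
  moreover have "k * d \<le> x" using x by simp
  ultimately have "d \<le> x" by (rule order_trans)
  then have "1 / real x \<le> 1 / real d" using assms(1) by (simp add: frac_le)
  also have "\<dots> \<le> real n / real d" using assms(2) by (intro divide_right_mono) auto
  finally have "0 \<le> real n / real d - 1 / real x" by simp
  then obtain Y where Y: "finite Y" "Y \<subseteq> {Max (insert x F)<..}"
    "(\<Sum>y\<in>Y. 1 / real y) = real n / real d - 1 / real x"
    using egyptian_fraction_beyond[of "real n / real d - 1 / real x" "Max (insert x F)"] by auto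
  have beyond: "z < y" if "y \<in> Y" "z \<in> insert x F" for y z
    using that Y(2) F by (meson Max_ge finite_insert greaterThan_iff le_less_trans subsetD)
  then have "x \<notin> Y" "insert x Y \<inter> F = {}" using x by (blast, fastforce)
  then have "sigma (insert x Y) = ennreal (real n / real d)"
    using Y by (simp add: sigma_finite)
  moreover have "insert x Y \<subseteq> {k * d..} - F"
    using x beyond \<open>insert x Y \<inter> F = {}\<close> by fastforce
  ultimately show "\<exists>X. finite X \<and> x \<in> X \<and> X \<subseteq> {k * d..} - F \<and>
      sigma X = ennreal (real n / real d)"
    using Y(1) by (intro exI[of _ "insert x Y"]) auto
qed

end
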